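(* Let $\mathbb D$ be the countable random poset. Then there is a countably infinite maximal antichain in $\langle\mathbb P(\mathbb D),\subset\rangle$.
   Context: The random poset $\mathbb D$ is the unique (up to isomorphism) countable ultrahomogeneous partial order into which every countable partial order embeds (ultrahomogeneous: every isomorphism between finite suborders extends to an automorphism). $\mathbb P(\mathbb D)$ is the set of subsets of $D$ whose induced order is isomorphic to $\mathbb D$, ordered by inclusion. Two elements are compatible iff they have a common lower bound in $\mathbb P(\mathbb D)$; an antichain is a set of pairwise incompatible elements, maximal iff every element is compatible with some member. *)

theory Defs
  imports "HOL-Library.Countable_Set"
begin

text \<open>
  A partial order is given by its reflexive order relation \<open>r\<close>, as in \<open>HOL.Order_Relation\<close>; its
  underlying set is \<open>Field r\<close>, and the order induced on \<open>A \<subseteq> Field r\<close> is \<open>Restr r A\<close>. The library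
  predicate \<open>iso\<close> is stated via initial segments, but for arbitrary relations it is
  equivalent to "bijective, preserves and reflects the relation" (\<open>iso_iff2\<close>). By contrast, the
  library's \<open>embed\<close> requires an image closed downwards and is not the embedding of partial orders;
  hence the definition of \<open>embeds_into\<close>.
\<close>

definition embeds_into :: "'b rel \<Rightarrow> 'a rel \<Rightarrow> bool" where
  "embeds_into s r \<longleftrightarrow>
     (\<exists>f. inj_on f (Field s) \<and> f ` Field s \<subseteq> Field r \<and>
          (\<forall>x\<in>Field s. \<forall>y\<in>Field s. (x, y) \<in> s \<longleftrightarrow> (f x, f y) \<in> r))"

definition ultrahomogeneous :: "'a rel \<Rightarrow> bool" where
  "ultrahomogeneous r \<longleftrightarrow>
     (\<forall>A B f. finite A \<and> A \<subseteq> Field r \<and> finite B \<and> B \<subseteq> Field r \<and> iso (Restr r A) (Restr r B) f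
        \<longrightarrow> (\<exists>g. iso r r g \<and> (\<forall>x\<in>A. g x = f x)))"

text \<open>
  A definition cannot quantify over types. Since every countable partial order is isomorphic to one
  whose underlying set consists of natural numbers, relations on \<open>nat\<close> suffice; the lemma below
  recovers the statement for all types.
\<close>

definition countably_universal :: "'a rel \<Rightarrow> bool" where
  "countably_universal r \<longleftrightarrow> (\<forall>s :: nat rel. Partial_order s \<longrightarrow> embeds_into s r)"

lemma countably_universal_embeds_into:
  fixes s :: "'b rel"
  assumes "countably_universal r" "Partial_order s" "countable (Field s)"
  shows "embeds_into s r"
proof -
  define h where "h = to_nat_on (Field s)"
  define t where "t = map_prod h h ` s"
  have h: "inj_on h (Field s)"
    unfolding h_def using assms(3) by (rule inj_on_to_nat_on)
  have F: "Field t = h ` Field s"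
    unfolding t_def Field_def by force
  have iff: "(h x, h y) \<in> t \<longleftrightarrow> (x, y) \<in> s" if "x \<in> Field s" "y \<in> Field s" for x y
  proof
    assume "(h x, h y) \<in> t"
    then obtain a b where ab: "(a, b) \<in> s" "h a = h x" "h b = h y"
      unfolding t_def by auto
    then have "a = x" "b = y"
      using h that by (metis FieldI1 FieldI2 inj_onD)+
    with ab show "(x, y) \<in> s" by simp
  qed (auto simp: t_def)
  note s = partial_order_onD[OF assms(2)]
  note tr = transD[OF s(2)] and an = antisymD[OF s(3)] and re = refl_onD[OF s(1)]
  have "t \<subseteq> Field t \<times> Field t"
    by (auto intro: FieldI1 FieldI2)
  moreover have "refl_on (Field t) t"
    unfolding F by (rule refl_onI) (use iff re in blast)
  moreover have "trans t"
  proof (rule transI)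
    fix x y z assume xy: "(x, y) \<in> t" and yz: "(y, z) \<in> t"
    from FieldI1[OF xy] obtain a where a: "a \<in> Field s" "x = h a" unfolding F by blast
    from FieldI1[OF yz] obtain b where b: "b \<in> Field s" "y = h b" unfolding F by blast
    from FieldI2[OF yz] obtain c where c: "c \<in> Field s" "z = h c" unfolding F by blast
    have "(a, b) \<in> s" "(b, c) \<in> s"
      using xy yz iff a b c by blast+
    then have "(a, c) \<in> s" by (rule tr)
    then show "(x, z) \<in> t" using iff a c by blast
  qed
  moreover have "antisym t"
  proof (rule antisymI)
    fix x y assume xy: "(x, y) \<in> t" and yx: "(y, x) \<in> t"
    from FieldI1[OF xy] obtain a where a: "a \<in> Field s" "x = h a" unfolding F by blast
    from FieldI1[OF yx] obtain b where b: "b \<in> Field s" "y = h b" unfolding F by blast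
    have "(a, b) \<in> s" "(b, a) \<in> s"
      using xy yx iff a b by blast+
    then have "a = b" by (rule an)
    then show "x = y" using a b by simp
  qed
  ultimately have "Partial_order t"
    by (simp add: order_on_defs)
  then have "embeds_into t r"
    using assms(1) by (simp add: countably_universal_def)
  then obtain f where f: "inj_on f (Field t)" "f ` Field t \<subseteq> Field r"
      "\<forall>x\<in>Field t. \<forall>y\<in>Field t. (x, y) \<in> t \<longleftrightarrow> (f x, f y) \<in> r"
    unfolding embeds_into_def by blast
  show ?thesis
    unfolding embeds_into_def
  proof (intro exI conjI)
    show "inj_on (f \<circ> h) (Field s)"
      using h f(1) F by (simp add: comp_inj_on)
    show "(f \<circ> h) ` Field s \<subseteq> Field r"
      using f(2) F by (simp add: image_comp)
    show "\<forall>x\<in>Field s. \<forall>y\<in>Field s. (x, y) \<in> s \<longleftrightarrow> ((f \<circ> h) x, (f \<circ> h) y) \<in> r"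
      using f(3) F iff by simp
  qed
qed

definition random_poset :: "'a rel \<Rightarrow> bool" where
  "random_poset r \<longleftrightarrow>
     Partial_order r \<and> countable (Field r) \<and> ultrahomogeneous r \<and> countably_universal r"

definition copies :: "'a rel \<Rightarrow> 'a set set" where
  "copies r = {A. A \<subseteq> Field r \<and> (\<exists>f. iso (Restr r A) r f)}"

text \<open>The inclusion order on \<open>copies r\<close> is the non-strict one.\<close>

definition copies_order :: "'a rel \<Rightarrow> 'a set rel" where
  "copies_order r = relation_of (\<subseteq>) (copies r)"

text \<open>
  Antichains are meant in the sense of forcing: distinct members have no common lower bound,
  which is stronger than being incomparable.
\<close>

definition compatible :: "'a rel \<Rightarrow> 'a \<Rightarrow> 'a \<Rightarrow> bool" where
  "compatible P x y \<longleftrightarrow> (\<exists>z\<in>Field P. (z, x) \<in> P \<and> (z, y) \<in> P)"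

definition antichain :: "'a rel \<Rightarrow> 'a set \<Rightarrow> bool" where
  "antichain P S \<longleftrightarrow> S \<subseteq> Field P \<and> pairwise (\<lambda>x y. \<not> compatible P x y) S"

definition maximal_antichain :: "'a rel \<Rightarrow> 'a set \<Rightarrow> bool" where
  "maximal_antichain P S \<longleftrightarrow> antichain P S \<and> (\<forall>x\<in>Field P. \<exists>y\<in>S. compatible P x y)"

end

theory Submission
  imports Defs
begin

text \<open>
  A subset of the random poset is a copy iff it has the one-point extension property (by back and
  forth). Enumerate the poset as \<open>d\<^sub>0, d\<^sub>1, \<dots>\<close> and let \<open>A\<^sub>n\<close> consist of the points strictly below
  \<open>d\<^sub>n\<close> that lie below no \<open>d\<^sub>m\<close> with \<open>m < n\<close>. The nonempty \<open>A\<^sub>n\<close> are pairwise disjoint copies, and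
  there are infinitely many of them because no finite set is cofinal. The map \<open>x \<mapsto> min {n. x \<le> d\<^sub>n}\<close>
  is monotone with values in a well-order, so if \<open>c\<close> minimises it on a copy \<open>C\<close>, with value \<open>n\<close>, then
  the cone \<open>{x \<in> C. x < c}\<close>, which is itself a copy, is contained in \<open>A\<^sub>n\<close>.
\<close>

section \<open>The one-point extension property\<close>

text \<open>This is the extension axiom of Fraisse theory for partial orders: \<open>L\<close>,
  \<open>G\<close> and \<open>I\<close> list the points that a new point must have strictly below,
  strictly above and incomparable to it. The three hypotheses are exactly what transitivity forces
  if such a point exists. Any of the sets may be empty.\<close>

definition one_point_ext :: "'a rel \<Rightarrow> 'a set \<Rightarrow> bool" where
  "one_point_ext r A \<longleftrightarrow>
     (\<forall>L G I. finite L \<and> finite G \<and> finite I \<and> L \<subseteq> A \<and> G \<subseteq> A \<and> I \<subseteq> A \<and>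
        (\<forall>l\<in>L. \<forall>g\<in>G. (l, g) \<in> r \<and> l \<noteq> g) \<and>
        (\<forall>l\<in>L. \<forall>i\<in>I. (i, l) \<notin> r) \<and> (\<forall>g\<in>G. \<forall>i\<in>I. (g, i) \<notin> r)
      \<longrightarrow> (\<exists>x\<in>A. (\<forall>l\<in>L. (l, x) \<in> r \<and> l \<noteq> x) \<and> (\<forall>g\<in>G. (x, g) \<in> r \<and> x \<noteq> g) \<and>
                 (\<forall>i\<in>I. (i, x) \<notin> r \<and> (x, i) \<notin> r)))"

lemma one_point_extI:
  assumes "\<And>L G I. finite L \<Longrightarrow> finite G \<Longrightarrow> finite I \<Longrightarrow> L \<subseteq> A \<Longrightarrow> G \<subseteq> A \<Longrightarrow> I \<subseteq> A \<Longrightarrow>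
    (\<And>l g. l \<in> L \<Longrightarrow> g \<in> G \<Longrightarrow> (l, g) \<in> r \<and> l \<noteq> g) \<Longrightarrow>
    (\<And>l i. l \<in> L \<Longrightarrow> i \<in> I \<Longrightarrow> (i, l) \<notin> r) \<Longrightarrow> (\<And>g i. g \<in> G \<Longrightarrow> i \<in> I \<Longrightarrow> (g, i) \<notin> r) \<Longrightarrow>
    \<exists>x\<in>A. (\<forall>l\<in>L. (l, x) \<in> r \<and> l \<noteq> x) \<and> (\<forall>g\<in>G. (x, g) \<in> r \<and> x \<noteq> g) \<and>
                 (\<forall>i\<in>I. (i, x) \<notin> r \<and> (x, i) \<notin> r)"
  shows "one_point_ext r A"
  unfolding one_point_ext_def
proof (intro allI impI, elim conjE)
  fix L G I
  assume "finite L" "finite G" "finite I" "L \<subseteq> A" "G \<subseteq> A" "I \<subseteq> A"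
    and "\<forall>l\<in>L. \<forall>g\<in>G. (l, g) \<in> r \<and> l \<noteq> g" "\<forall>l\<in>L. \<forall>i\<in>I. (i, l) \<notin> r" "\<forall>g\<in>G. \<forall>i\<in>I. (g, i) \<notin> r"
  then show "\<exists>x\<in>A. (\<forall>l\<in>L. (l, x) \<in> r \<and> l \<noteq> x) \<and> (\<forall>g\<in>G. (x, g) \<in> r \<and> x \<noteq> g) \<and>
                 (\<forall>i\<in>I. (i, x) \<notin> r \<and> (x, i) \<notin> r)"
    by (intro assms) auto
qed

lemma one_point_extE:
  assumes "one_point_ext r A" "finite L" "finite G" "finite I" "L \<subseteq> A" "G \<subseteq> A" "I \<subseteq> A"
    and "\<And>l g. l \<in> L \<Longrightarrow> g \<in> G \<Longrightarrow> (l, g) \<in> r \<and> l \<noteq> g"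
    and "\<And>l i. l \<in> L \<Longrightarrow> i \<in> I \<Longrightarrow> (i, l) \<notin> r"
    and "\<And>g i. g \<in> G \<Longrightarrow> i \<in> I \<Longrightarrow> (g, i) \<notin> r"
  obtains x where "x \<in> A" "\<And>l. l \<in> L \<Longrightarrow> (l, x) \<in> r \<and> l \<noteq> x"
    "\<And>g. g \<in> G \<Longrightarrow> (x, g) \<in> r \<and> x \<noteq> g" "\<And>i. i \<in> I \<Longrightarrow> (i, x) \<notin> r \<and> (x, i) \<notin> r"
proof -
  have "\<exists>x\<in>A. (\<forall>l\<in>L. (l, x) \<in> r \<and> l \<noteq> x) \<and> (\<forall>g\<in>G. (x, g) \<in> r \<and> x \<noteq> g) \<and>
                 (\<forall>i\<in>I. (i, x) \<notin> r \<and> (x, i) \<notin> r)"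
    using assms(2-) by (intro assms(1)[unfolded one_point_ext_def, rule_format]) blast
  with that show ?thesis by blast
qed

lemma one_point_ext_nonempty: "one_point_ext r A \<Longrightarrow> A \<noteq> {}"
  by (erule one_point_extE[of r A "{}" "{}" "{}"]) auto

text \<open>The prescribed sets are moved along \<open>f\<close>, realised in \<open>B\<close>, and
  the realising point is pulled back. This is how copies inherit the property from the whole
  poset.\<close>

lemma one_point_ext_cong:
  assumes bij: "bij_betw f A B"
    and iff: "\<And>a b. a \<in> A \<Longrightarrow> b \<in> A \<Longrightarrow> (a, b) \<in> r \<longleftrightarrow> (f a, f b) \<in> s"
    and ext: "one_point_ext s B"
  shows "one_point_ext r A"
proof (rule one_point_extI)
  fix L G I
  assume fin: "finite L" "finite G" "finite I" and sub: "L \<subseteq> A" "G \<subseteq> A" "I \<subseteq> A"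
    and LG: "\<And>l g. l \<in> L \<Longrightarrow> g \<in> G \<Longrightarrow> (l, g) \<in> r \<and> l \<noteq> g"
    and LI: "\<And>l i. l \<in> L \<Longrightarrow> i \<in> I \<Longrightarrow> (i, l) \<notin> r"
    and GI: "\<And>g i. g \<in> G \<Longrightarrow> i \<in> I \<Longrightarrow> (g, i) \<notin> r"
  have inj: "f a = f b \<longleftrightarrow> a = b" if "a \<in> A" "b \<in> A" for a b
    using bij that by (auto simp: bij_betw_def inj_on_def)
  obtain y where y: "y \<in> B" "\<And>l. l \<in> f ` L \<Longrightarrow> (l, y) \<in> s \<and> l \<noteq> y"
    "\<And>g. g \<in> f ` G \<Longrightarrow> (y, g) \<in> s \<and> y \<noteq> g" "\<And>i. i \<in> f ` I \<Longrightarrow> (i, y) \<notin> s \<and> (y, i) \<notin> s"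
  proof (rule one_point_extE[OF ext])
    show "f ` L \<subseteq> B" "f ` G \<subseteq> B" "f ` I \<subseteq> B"
      using bij sub by (auto simp: bij_betw_def)
    show "(l, g) \<in> s \<and> l \<noteq> g" if "l \<in> f ` L" "g \<in> f ` G" for l g
      using that LG sub iff inj by (auto simp: subset_iff)
    show "(i, l) \<notin> s" if "l \<in> f ` L" "i \<in> f ` I" for l i
      using that LI sub iff by (auto simp: subset_iff)
    show "(g, i) \<notin> s" if "g \<in> f ` G" "i \<in> f ` I" for g i
      using that GI sub iff by (auto simp: subset_iff)
  qed (use fin in auto)
  obtain x where x: "x \<in> A" "f x = y"
    using y(1) bij by (auto simp: bij_betw_def)
  show "\<exists>x\<in>A. (\<forall>l\<in>L. (l, x) \<in> r \<and> l \<noteq> x) \<and> (\<forall>g\<in>G. (x, g) \<in> r \<and> x \<noteq> g) \<and>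
                 (\<forall>i\<in>I. (i, x) \<notin> r \<and> (x, i) \<notin> r)"
    using x y(2-) sub iff by (intro bexI[of _ x]) (auto simp: subset_iff)
qed

section \<open>Back and forth in a partial order\<close>

locale poset =
  fixes r :: "'a rel"
  assumes partial_order: "Partial_order r"
begin

lemma refl: "x \<in> Field r \<Longrightarrow> (x, x) \<in> r"
  using partial_order_onD(1)[OF partial_order] by (rule refl_onD)

lemma trans: "(x, y) \<in> r \<Longrightarrow> (y, z) \<in> r \<Longrightarrow> (x, z) \<in> r"
  using partial_order_onD(2)[OF partial_order] by (rule transD)

lemma antisym: "(x, y) \<in> r \<Longrightarrow> (y, x) \<in> r \<Longrightarrow> x = y"
  using partial_order_onD(3)[OF partial_order] by (rule antisymD)

text \<open>By reflexivity each point of \<open>A\<close> keeps its loop, so isolated points are not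
  lost from the field.\<close>

lemma Field_Restr: "A \<subseteq> Field r \<Longrightarrow> Field (Restr r A) = A"
  using refl by (fastforce simp: Field_def)

lemma iso_Restr_iff:
  assumes "A \<subseteq> Field r" "B \<subseteq> Field r"
  shows "iso (Restr r A) (Restr r B) f \<longleftrightarrow>
    bij_betw f A B \<and> (\<forall>a\<in>A. \<forall>b\<in>A. (a, b) \<in> r \<longleftrightarrow> (f a, f b) \<in> r)"
  unfolding iso_iff2 Field_Restr[OF assms(1)] Field_Restr[OF assms(2)]
  by (auto simp: bij_betw_def)

lemma Restr_Field: "Restr r (Field r) = r"
  by (auto intro: FieldI1 FieldI2)

text \<open>A relation rather than a function, so that the back step is the forth step for the
  converse. For \<open>A\<close> and \<open>B\<close> inside \<open>Field r\<close>, reflexivity and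
  antisymmetry make it single-valued and injective.\<close>

definition partial_iso :: "'a set \<Rightarrow> 'a set \<Rightarrow> 'a rel \<Rightarrow> bool" where
  "partial_iso A B p \<longleftrightarrow> finite p \<and> p \<subseteq> A \<times> B \<and>
     (\<forall>(a, b)\<in>p. \<forall>(a', b')\<in>p. (a, a') \<in> r \<longleftrightarrow> (b, b') \<in> r)"

lemma partial_iso_converse: "partial_iso A B p \<Longrightarrow> partial_iso B A (p\<inverse>)"
  unfolding partial_iso_def by fastforce

lemma partial_isoD:
  "partial_iso A B p \<Longrightarrow> (a, b) \<in> p \<Longrightarrow> (a', b') \<in> p \<Longrightarrow> (a, a') \<in> r \<longleftrightarrow> (b, b') \<in> r"
  unfolding partial_iso_def by blast

text \<open>The partner \<open>b\<close> of \<open>a\<close> is chosen to stand to the range of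
  \<open>p\<close> as \<open>a\<close> stands to its domain; one-point extension in \<open>B\<close>
  supplies it.\<close>

lemma partial_iso_forth:
  assumes p: "partial_iso A B p" and A: "A \<subseteq> Field r" and B: "B \<subseteq> Field r"
    and ext: "one_point_ext r B" and a: "a \<in> A"
  shows "\<exists>q. partial_iso A B q \<and> p \<subseteq> q \<and> a \<in> Domain q"
proof (cases "a \<in> Domain p")
  case True
  with p show ?thesis by blast
next
  case False
  note D = partial_isoD[OF p]
  have fin: "finite p" and sub: "p \<subseteq> A \<times> B"
    using p by (auto simp: partial_iso_def)
  define L where "L = {b'. \<exists>a'. (a', b') \<in> p \<and> (a', a) \<in> r}"
  define G where "G = {b'. \<exists>a'. (a', b') \<in> p \<and> (a, a') \<in> r}"
  define I where "I = {b'. \<exists>a'. (a', b') \<in> p \<and> (a', a) \<notin> r \<and> (a, a') \<notin> r}"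
  have LGI: "L \<subseteq> snd ` p" "G \<subseteq> snd ` p" "I \<subseteq> snd ` p"
    unfolding L_def G_def I_def by force+
  obtain b where b: "b \<in> B" "\<And>l. l \<in> L \<Longrightarrow> (l, b) \<in> r \<and> l \<noteq> b"
    "\<And>g. g \<in> G \<Longrightarrow> (b, g) \<in> r \<and> b \<noteq> g" "\<And>i. i \<in> I \<Longrightarrow> (i, b) \<notin> r \<and> (b, i) \<notin> r"
  proof (rule one_point_extE[OF ext])
    show "finite L" "finite G" "finite I"
      using LGI fin by (auto intro: finite_subset)
    show "L \<subseteq> B" "G \<subseteq> B" "I \<subseteq> B"
      using LGI sub by force+
    \<comment> \<open>The comparison passes through \<open>u <= a <= v\<close>. If
      \<open>l = g\<close>, then also \<open>v <= u\<close>, so \<open>a = u\<close> would already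
      be in the domain.\<close>
    show "(l, g) \<in> r \<and> l \<noteq> g" if l: "l \<in> L" and g: "g \<in> G" for l g
    proof -
      obtain u where u: "(u, l) \<in> p" "(u, a) \<in> r" using l by (auto simp: L_def)
      obtain v where v: "(v, g) \<in> p" "(a, v) \<in> r" using g by (auto simp: G_def)
      have "(l, g) \<in> r" using D[OF u(1) v(1)] trans[OF u(2) v(2)] by simp
      moreover have False if "l = g"
      proof -
        have "(v, u) \<in> r"
          using D[OF v(1) u(1)] that \<open>(l, g) \<in> r\<close> by simp
        then have "u = a" using u(2) v(2) antisym trans by blast
        with False u(1) show False by blast
      qed
      ultimately show ?thesis by blast
    qed
    show "(i, l) \<notin> r" if "l \<in> L" "i \<in> I" for l i
      using that D trans unfolding L_def I_def by blast
    show "(g, i) \<notin> r" if "g \<in> G" "i \<in> I" for g i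
      using that D trans unfolding G_def I_def by blast
  qed (rule that)
  \<comment> \<open>As \<open>a\<close> is not in the domain, exactly one of strictly below,
    strictly above and incomparable holds. Strictness on the side of \<open>b\<close> and
    antisymmetry exclude the reverse comparison.\<close>
  have below: "(a', a) \<in> r \<longleftrightarrow> (b', b) \<in> r" and above: "(a, a') \<in> r \<longleftrightarrow> (b, b') \<in> r"
    if ab: "(a', b') \<in> p" for a' b'
  proof -
    consider "(a', a) \<in> r" "(a, a') \<notin> r" | "(a, a') \<in> r" "(a', a) \<notin> r"
      | "(a', a) \<notin> r" "(a, a') \<notin> r"
      using antisym False ab by blast
    then have "((a', a) \<in> r \<longleftrightarrow> (b', b) \<in> r) \<and> ((a, a') \<in> r \<longleftrightarrow> (b, b') \<in> r)"
    proof cases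
      case 1
      then have "b' \<in> L" using ab by (auto simp: L_def)
      then show ?thesis using b(2) 1 antisym by blast
    next
      case 2
      then have "b' \<in> G" using ab by (auto simp: G_def)
      then show ?thesis using b(3) 2 antisym by blast
    next
      case 3
      then have "b' \<in> I" using ab by (auto simp: I_def)
      then show ?thesis using b(4) 3 by blast
    qed
    then show "(a', a) \<in> r \<longleftrightarrow> (b', b) \<in> r" "(a, a') \<in> r \<longleftrightarrow> (b, b') \<in> r" by auto
  qed
  have "(a, a) \<in> r \<longleftrightarrow> (b, b) \<in> r"
    using refl a A b(1) B by blast
  with p a b(1) below above have "partial_iso A B (insert (a, b) p)"
    unfolding partial_iso_def by auto
  then show ?thesis by blast
qed

lemma partial_iso_back_forth:
  assumes p: "partial_iso A B p" and A: "A \<subseteq> Field r" and B: "B \<subseteq> Field r"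
    and ext: "one_point_ext r A" "one_point_ext r B" and "a \<in> A" "b \<in> B"
  shows "\<exists>q. partial_iso A B q \<and> p \<subseteq> q \<and> a \<in> Domain q \<and> b \<in> Range q"
proof -
  obtain q where q: "partial_iso A B q" "p \<subseteq> q" "a \<in> Domain q"
    using partial_iso_forth[OF p A B ext(2) \<open>a \<in> A\<close>] by blast
  obtain q' where q': "partial_iso B A q'" "q\<inverse> \<subseteq> q'" "b \<in> Domain q'"
    using partial_iso_forth[OF partial_iso_converse[OF q(1)] B A ext(1) \<open>b \<in> B\<close>] by blast
  have "q \<subseteq> q'\<inverse>" using q'(2) by (simp add: converse_subset_swap)
  then have "p \<subseteq> q'\<inverse>" "a \<in> Domain (q'\<inverse>)" "b \<in> Range (q'\<inverse>)"
    using q(2,3) q'(3) by blast+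
  with partial_iso_converse[OF q'(1)] show ?thesis by (intro exI conjI)
qed

text \<open>Cantor's back and forth: an increasing chain of finite partial isomorphisms absorbs
  enumerations of both sets, and its union is the graph of an isomorphism.\<close>

lemma one_point_ext_iso:
  assumes A: "A \<subseteq> Field r" "countable A" "one_point_ext r A"
    and B: "B \<subseteq> Field r" "countable B" "one_point_ext r B"
  shows "\<exists>f. iso (Restr r A) (Restr r B) f"
proof -
  note ne = one_point_ext_nonempty[OF A(3)] one_point_ext_nonempty[OF B(3)]
  \<comment> \<open>Stage \<open>n\<close> takes care of the \<open>n\<close>-th point of each
    enumeration; nonemptiness (\<open>ne\<close>) keeps the values of \<open>from_nat_into\<close>
    inside the sets.\<close>
  define step where "step n p q \<longleftrightarrow>
    p \<subseteq> q \<and> from_nat_into A n \<in> Domain q \<and> from_nat_into B n \<in> Range q" for n p q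
  have "\<exists>P. \<forall>n. partial_iso A B (P n) \<and> step n (P n) (P (Suc n))"
  proof (rule dependent_nat_choice)
    show "\<exists>p. partial_iso A B p"
      by (intro exI[of _ "{}"]) (simp add: partial_iso_def)
    show "\<exists>q. partial_iso A B q \<and> step n p q" if "partial_iso A B p" for p n
      unfolding step_def
      using partial_iso_back_forth[OF that A(1) B(1) A(3) B(3)] ne from_nat_into by metis
  qed
  then obtain P where P: "\<And>n. partial_iso A B (P n)" and step: "\<And>n. step n (P n) (P (Suc n))"
    by blast
  have mono: "P m \<subseteq> P n" if "m \<le> n" for m n
    using step by (intro lift_Suc_mono_le[OF _ that]) (simp add: step_def)
  define Q where "Q = (\<Union>n. P n)"
  have iff: "(a, a') \<in> r \<longleftrightarrow> (b, b') \<in> r" if ab: "(a, b) \<in> Q" "(a', b') \<in> Q" for a b a' b'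
  proof -
    obtain m n where "(a, b) \<in> P m" "(a', b') \<in> P n"
      using ab by (auto simp: Q_def)
    then have "(a, b) \<in> P (max m n)" "(a', b') \<in> P (max m n)"
      using mono[of m "max m n"] mono[of n "max m n"] by auto
    then show ?thesis by (rule partial_isoD[OF P])
  qed
  have sub: "Q \<subseteq> A \<times> B"
    using P by (auto simp: Q_def partial_iso_def)
  have dom: "\<exists>b. (a, b) \<in> Q" if a: "a \<in> A" for a
  proof -
    obtain n where "from_nat_into A n = a"
      using from_nat_into_surj[OF A(2) a] by blast
    then show ?thesis
      using step[of n] by (auto simp: step_def Q_def)
  qed
  have ran: "\<exists>a. (a, b) \<in> Q" if b: "b \<in> B" for b
  proof -
    obtain n where "from_nat_into B n = b"
      using from_nat_into_surj[OF B(2) b] by blast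
    then show ?thesis
      using step[of n] by (auto simp: step_def Q_def)
  qed
  obtain f where f: "\<And>a. a \<in> A \<Longrightarrow> (a, f a) \<in> Q"
    using dom by metis
  \<comment> \<open>Two partners of \<open>a\<close> are related in both directions because
    \<open>(a, a) \<in> r\<close>; hence \<open>Q\<close> is the graph of \<open>f\<close>.\<close>
  have fQ: "f a = b" if "(a, b) \<in> Q" for a b
  proof -
    have "a \<in> A" using that sub by blast
    then have "(b, f a) \<in> r" "(f a, b) \<in> r"
      using iff[OF that f] iff[OF f that] refl A(1) by blast+
    then show ?thesis using antisym by blast
  qed
  have "iso (Restr r A) (Restr r B) f"
    unfolding iso_Restr_iff[OF A(1) B(1)]
  proof (intro conjI ballI)
    show "(a, b) \<in> r \<longleftrightarrow> (f a, f b) \<in> r" if "a \<in> A" "b \<in> A" for a b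
      using that f iff by blast
    have "inj_on f A"
    proof (rule inj_onI)
      fix x y assume xy: "x \<in> A" "y \<in> A" "f x = f y"
      have "(f x, f x) \<in> r" using f[OF xy(1)] sub B(1) refl by blast
      then have "(x, y) \<in> r" "(y, x) \<in> r"
        using iff[OF f f, OF xy(1,2)] iff[OF f f, OF xy(2,1)] xy(3) by simp_all
      then show "x = y" by (rule antisym)
    qed
    moreover have "f ` A = B"
      using f fQ ran sub by fast
    ultimately show "bij_betw f A B" by (simp add: bij_betw_def)
  qed
  then show ?thesis by blast
qed

text \<open>Adding \<open>c\<close> to the upper constraints forces the point realised in
  \<open>C\<close> into the cone.\<close>

lemma one_point_ext_below:
  assumes C: "C \<subseteq> Field r" "one_point_ext r C" and c: "c \<in> C"
  shows "one_point_ext r {x \<in> C. (x, c) \<in> r \<and> x \<noteq> c}"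
proof (rule one_point_extI)
  fix L G I
  let ?E = "{x \<in> C. (x, c) \<in> r \<and> x \<noteq> c}"
  assume fin: "finite L" "finite G" "finite I" and sub: "L \<subseteq> ?E" "G \<subseteq> ?E" "I \<subseteq> ?E"
    and LG: "\<And>l g. l \<in> L \<Longrightarrow> g \<in> G \<Longrightarrow> (l, g) \<in> r \<and> l \<noteq> g"
    and LI: "\<And>l i. l \<in> L \<Longrightarrow> i \<in> I \<Longrightarrow> (i, l) \<notin> r"
    and GI: "\<And>g i. g \<in> G \<Longrightarrow> i \<in> I \<Longrightarrow> (g, i) \<notin> r"
  obtain x where x: "x \<in> C" "\<And>l. l \<in> L \<Longrightarrow> (l, x) \<in> r \<and> l \<noteq> x"
    "\<And>g. g \<in> insert c G \<Longrightarrow> (x, g) \<in> r \<and> x \<noteq> g" "\<And>i. i \<in> I \<Longrightarrow> (i, x) \<notin> r \<and> (x, i) \<notin> r"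
  proof (rule one_point_extE[OF C(2)])
    show "finite L" "finite (insert c G)" "finite I"
      using fin by simp_all
    show "L \<subseteq> C" "insert c G \<subseteq> C" "I \<subseteq> C"
      using sub c by auto
    show "(l, g) \<in> r \<and> l \<noteq> g" if "l \<in> L" "g \<in> insert c G" for l g
      using that LG sub(1) by auto
    show "(i, l) \<notin> r" if "l \<in> L" "i \<in> I" for l i
      using that by (rule LI)
    \<comment> \<open>For \<open>g = c\<close> this holds because \<open>i\<close> is strictly below
      \<open>c\<close>.\<close>
    show "(g, i) \<notin> r" if "g \<in> insert c G" "i \<in> I" for g i
      using that GI antisym sub(3) by fastforce
  qed (rule that)
  have "x \<in> ?E" using x(1,3) by simp
  with x(2-4) show "\<exists>x\<in>?E. (\<forall>l\<in>L. (l, x) \<in> r \<and> l \<noteq> x) \<and> (\<forall>g\<in>G. (x, g) \<in> r \<and> x \<noteq> g) \<and>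
                 (\<forall>i\<in>I. (i, x) \<notin> r \<and> (x, i) \<notin> r)"
    by (intro bexI[of _ x]) simp_all
qed

end

section \<open>The random poset and its copies\<close>

locale random = poset +
  assumes countable: "countable (Field r)"
    and homogeneous: "ultrahomogeneous r"
    and universal: "countably_universal r"
begin

text \<open>
  Add a formal point \<open>None\<close> to the finite suborder, embed the result by universality, and move the
  image back over the suborder by homogeneity.
\<close>

lemma one_point_ext_Field: "one_point_ext r (Field r)"
proof (rule one_point_extI)
  fix L G I
  assume fin: "finite L" "finite G" "finite I"
    and sub: "L \<subseteq> Field r" "G \<subseteq> Field r" "I \<subseteq> Field r"
    and LG: "\<And>l g. l \<in> L \<Longrightarrow> g \<in> G \<Longrightarrow> (l, g) \<in> r \<and> l \<noteq> g"
    and LI: "\<And>l i. l \<in> L \<Longrightarrow> i \<in> I \<Longrightarrow> (i, l) \<notin> r"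
    and GI: "\<And>g i. g \<in> G \<Longrightarrow> i \<in> I \<Longrightarrow> (g, i) \<notin> r"
  define F where "F = L \<union> G \<union> I"
  have F: "finite F" "F \<subseteq> Field r" using fin sub by (auto simp: F_def)
  \<comment> \<open>\<open>None\<close> is placed above the down-closure of \<open>L\<close> in
    \<open>F\<close> and below the up-closure of \<open>G\<close>, the relations that transitivity
    forces, and is incomparable to all other points.\<close>
  define s where "s = {(Some u, Some v) | u v. u \<in> F \<and> v \<in> F \<and> (u, v) \<in> r} \<union> {(None, None)} \<union>
    {(Some u, None) | u. u \<in> F \<and> (\<exists>l\<in>L. (u, l) \<in> r)} \<union>
    {(None, Some v) | v. v \<in> F \<and> (\<exists>g\<in>G. (g, v) \<in> r)}"
  have s_simps:
    "(Some u, Some v) \<in> s \<longleftrightarrow> u \<in> F \<and> v \<in> F \<and> (u, v) \<in> r"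
    "(Some u, None) \<in> s \<longleftrightarrow> u \<in> F \<and> (\<exists>l\<in>L. (u, l) \<in> r)"
    "(None, Some v) \<in> s \<longleftrightarrow> v \<in> F \<and> (\<exists>g\<in>G. (g, v) \<in> r)"
    "(None, None) \<in> s" for u v
    by (auto simp: s_def)
  have Fs: "Field s = insert None (Some ` F)"
  proof
    show "Field s \<subseteq> insert None (Some ` F)"
      by (auto simp: s_def Field_def)
    have "(x, x) \<in> s" if "x \<in> insert None (Some ` F)" for x
      using that F(2) refl s_simps by auto
    then show "insert None (Some ` F) \<subseteq> Field s"
      by (auto intro: FieldI1)
  qed
  have "s \<subseteq> Field s \<times> Field s" by (auto intro: FieldI1 FieldI2)
  moreover have "refl_on (Field s) s"
    by (rule refl_onI) (use F(2) refl s_simps in \<open>auto simp: Fs\<close>)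
  moreover have "trans s"
  proof (rule transI)
    fix x y z assume "(x, y) \<in> s" "(y, z) \<in> s"
    then show "(x, z) \<in> s"
      by (cases x; cases y; cases z) (simp_all add: s_simps, (meson LG trans)+)
  qed
  moreover have "antisym s"
  proof (rule antisymI)
    fix x y assume "(x, y) \<in> s" "(y, x) \<in> s"
    then show "x = y"
      by (cases x; cases y) (simp_all add: s_simps, (metis LG trans antisym)+)
  qed
  ultimately have "Partial_order s" by (simp add: order_on_defs)
  moreover have "countable (Field s)" using F(1) by (simp add: Fs countable_finite)
  ultimately have "embeds_into s r"
    using countably_universal_embeds_into[OF universal] by blast
  then obtain f where f: "inj_on f (Field s)" "f ` Field s \<subseteq> Field r"
    and "\<forall>x\<in>Field s. \<forall>y\<in>Field s. (x, y) \<in> s \<longleftrightarrow> (f x, f y) \<in> r"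
    unfolding embeds_into_def by (elim exE conjE)
  then have fr: "(x, y) \<in> s \<longleftrightarrow> (f x, f y) \<in> r" if "x \<in> Field s" "y \<in> Field s" for x y
    using that by simp
  define h where "h = f \<circ> Some"
  define k where "k = inv_into F h"
  have injh: "inj_on h F"
    using f(1) by (auto simp: h_def Fs inj_on_def)
  have kh: "k (h u) = u" if "u \<in> F" for u
    using injh that by (simp add: k_def)
  have hF: "h ` F \<subseteq> Field r" using f(2) by (auto simp: h_def Fs)
  have hr: "(h u, h v) \<in> r \<longleftrightarrow> (u, v) \<in> r" if "u \<in> F" "v \<in> F" for u v
    using fr[of "Some u" "Some v"] that by (simp add: h_def Fs s_simps)
  have "bij_betw k (h ` F) F"
    unfolding k_def by (rule bij_betw_inv_into[OF inj_on_imp_bij_betw[OF injh]])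
  then have "iso (Restr r (h ` F)) (Restr r F) k"
    unfolding iso_Restr_iff[OF hF F(2)] by (simp add: kh hr)
  then obtain g where g: "iso r r g" "\<And>x. x \<in> h ` F \<Longrightarrow> g x = k x"
    using homogeneous[unfolded ultrahomogeneous_def, rule_format, of "h ` F" F k] F hF by auto
  have gb: "bij_betw g (Field r) (Field r)"
    and gr: "\<And>a b. a \<in> Field r \<Longrightarrow> b \<in> Field r \<Longrightarrow> (g a, g b) \<in> r \<longleftrightarrow> (a, b) \<in> r"
    using g(1) by (auto simp: iso_iff2)
  define x where "x = g (f None)"
  have fN: "f None \<in> Field r" using f(2) by (auto simp: Fs)
  then have x: "x \<in> Field r" using gb by (auto simp: x_def bij_betw_def)
  have gh: "g (h u) = u" if "u \<in> F" for u
    using g(2) kh that by simp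
  have SF: "Some u \<in> Field s" "None \<in> Field s" "h u \<in> Field r" if "u \<in> F" for u
    using that hF by (auto simp: Fs)
  have ux: "(u, x) \<in> r \<longleftrightarrow> (\<exists>l\<in>L. (u, l) \<in> r)" if u: "u \<in> F" for u
  proof -
    have "(u, x) \<in> r \<longleftrightarrow> (h u, f None) \<in> r"
      using gr[OF SF(3)[OF u] fN] by (simp add: gh[OF u] x_def)
    also have "\<dots> \<longleftrightarrow> (Some u, None) \<in> s"
      using fr[OF SF(1,2), OF u u] by (simp add: h_def)
    finally show ?thesis using u by (simp add: s_simps)
  qed
  have xu: "(x, u) \<in> r \<longleftrightarrow> (\<exists>g\<in>G. (g, u) \<in> r)" if u: "u \<in> F" for u
  proof -
    have "(x, u) \<in> r \<longleftrightarrow> (f None, h u) \<in> r"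
      using gr[OF fN SF(3)[OF u]] by (simp add: gh[OF u] x_def)
    also have "\<dots> \<longleftrightarrow> (None, Some u) \<in> s"
      using fr[OF SF(2,1), OF u u] by (simp add: h_def)
    finally show ?thesis using u by (simp add: s_simps)
  qed
  \<comment> \<open>If \<open>u = x\<close>, then \<open>g <= u <= l\<close> for some
    \<open>l\<close> in \<open>L\<close> and \<open>g\<close> in \<open>G\<close>, although
    \<open>l\<close> is strictly below \<open>g\<close>.\<close>
  have ne: "u \<noteq> x" if u: "u \<in> F" for u
  proof
    assume "u = x"
    then have "(u, x) \<in> r" "(x, u) \<in> r" using refl[OF x] by simp_all
    then obtain l g where lg: "l \<in> L" "(u, l) \<in> r" "g \<in> G" "(g, u) \<in> r"
      unfolding ux[OF u] xu[OF u] by blast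
    then have "(l, g) \<in> r" "l \<noteq> g" using LG by simp_all
    then show False using trans[OF lg(4,2)] antisym by blast
  qed
  show "\<exists>x\<in>Field r. (\<forall>l\<in>L. (l, x) \<in> r \<and> l \<noteq> x) \<and> (\<forall>g\<in>G. (x, g) \<in> r \<and> x \<noteq> g) \<and>
                 (\<forall>i\<in>I. (i, x) \<notin> r \<and> (x, i) \<notin> r)"
  proof (intro bexI[of _ x] conjI ballI)
    fix l assume l: "l \<in> L"
    then have "l \<in> F" by (simp add: F_def)
    with l show "(l, x) \<in> r" "l \<noteq> x" using ux ne refl sub by blast+
  next
    fix g assume g: "g \<in> G"
    then have "g \<in> F" by (simp add: F_def)
    with g show "(x, g) \<in> r" "x \<noteq> g" using xu ne refl sub by blast+
  next
    fix i assume i: "i \<in> I"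
    then have "i \<in> F" by (simp add: F_def)
    with i show "(i, x) \<notin> r" "(x, i) \<notin> r" using xu ux LI GI by blast+
  qed (rule x)
qed

text \<open>An isomorphism transports the property from \<open>Field r\<close> to \<open>A\<close>;
  conversely, back and forth runs between \<open>A\<close> and \<open>Field r\<close>.\<close>

lemma copies_iff: "A \<in> copies r \<longleftrightarrow> A \<subseteq> Field r \<and> one_point_ext r A"
proof
  assume "A \<in> copies r"
  then obtain f where A: "A \<subseteq> Field r" and "iso (Restr r A) r f"
    by (auto simp: copies_def)
  then have "bij_betw f A (Field r)" "\<forall>a\<in>A. \<forall>b\<in>A. (a, b) \<in> r \<longleftrightarrow> (f a, f b) \<in> r"
    using iso_Restr_iff[OF A subset_refl] by (simp_all add: Restr_Field)
  then have "one_point_ext r A"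
    by (intro one_point_ext_cong[OF _ _ one_point_ext_Field]) auto
  with A show "A \<subseteq> Field r \<and> one_point_ext r A" by simp
next
  assume A: "A \<subseteq> Field r \<and> one_point_ext r A"
  then have "countable A" using countable by (blast intro: countable_subset)
  then have "\<exists>f. iso (Restr r A) (Restr r (Field r)) f"
    using A countable one_point_ext_Field by (intro one_point_ext_iso) auto
  with A show "A \<in> copies r"
    by (simp add: copies_def Restr_Field)
qed

lemma Field_copies_order: "Field (copies_order r) = copies r"
  by (auto simp: copies_order_def relation_of_def Field_def)

lemma compatible_copies_iff:
  "A \<in> copies r \<Longrightarrow> B \<in> copies r \<Longrightarrow>
    compatible (copies_order r) A B \<longleftrightarrow> (\<exists>C\<in>copies r. C \<subseteq> A \<and> C \<subseteq> B)"
  unfolding compatible_def Field_copies_order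
  by (auto simp: copies_order_def relation_of_def)

section \<open>Layers below an enumeration\<close>

definition d :: "nat \<Rightarrow> 'a" where
  "d = from_nat_into (Field r)"

text \<open>The point \<open>d n\<close> is left out because it would be a largest element, which no
  copy has.\<close>

definition layer :: "nat \<Rightarrow> 'a set" where
  "layer n = {x. (x, d n) \<in> r \<and> x \<noteq> d n \<and> (\<forall>m<n. (x, d m) \<notin> r)}"

text \<open>These are the indices of the nonempty layers: if \<open>d n\<close> lies below an
  earlier \<open>d m\<close>, so does everything below \<open>d n\<close>.\<close>

definition records :: "nat set" where
  "records = {n. \<forall>m<n. (d n, d m) \<notin> r}"

lemma d_in_Field: "d n \<in> Field r"
  unfolding d_def by (intro from_nat_into one_point_ext_nonempty[OF one_point_ext_Field])

lemma d_surj: "x \<in> Field r \<Longrightarrow> \<exists>n. d n = x"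
  unfolding d_def by (rule from_nat_into_surj[OF countable])

text \<open>The data are realised in the whole poset with \<open>d n\<close> as a further upper
  constraint, while staying out of the cones of the earlier \<open>d m\<close>.\<close>

lemma layer_copy:
  assumes "n \<in> records"
  shows "layer n \<in> copies r"
  unfolding copies_iff
proof
  show Field: "layer n \<subseteq> Field r"
    by (auto simp: layer_def intro: FieldI1)
  show "one_point_ext r (layer n)"
  proof (rule one_point_extI, goal_cases)
    case (1 L G I)
    note sub = 1(4-6)
    \<comment> \<open>If \<open>L\<close> is nonempty, then a point above \<open>L\<close> is not below any earlier \<open>d m\<close>.\<close>
    define J where "J = (if L = {} then d ` {..<n} else {})"
    obtain x where x: "x \<in> Field r" "\<And>l. l \<in> L \<Longrightarrow> (l, x) \<in> r \<and> l \<noteq> x"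
      "\<And>g. g \<in> insert (d n) G \<Longrightarrow> (x, g) \<in> r \<and> x \<noteq> g"
      "\<And>i. i \<in> I \<union> J \<Longrightarrow> (i, x) \<notin> r \<and> (x, i) \<notin> r"
    proof (rule one_point_extE[OF one_point_ext_Field, of L "insert (d n) G" "I \<union> J"])
      show "L \<subseteq> Field r" "insert (d n) G \<subseteq> Field r" "I \<union> J \<subseteq> Field r"
        using sub Field d_in_Field by (auto simp: J_def)
      show "(l, g) \<in> r \<and> l \<noteq> g" if "l \<in> L" "g \<in> insert (d n) G" for l g
        using that 1(7) sub(1) by (auto simp: layer_def)
      \<comment> \<open>This is why \<open>J\<close> is empty once \<open>L\<close> is not: an
        earlier \<open>d m\<close> may lie below a point of \<open>L\<close>.\<close>
      show "(i, l) \<notin> r" if "l \<in> L" "i \<in> I \<union> J" for l i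
        using that 1(8) by (auto simp: J_def split: if_splits)
      \<comment> \<open>A point of \<open>I\<close> is strictly below \<open>d n\<close>, which
        settles \<open>g = d n\<close>. For \<open>i = d m\<close> in \<open>J\<close>, points of
        the layer avoid the cone of \<open>d m\<close> by definition, and \<open>d n\<close> does so
        because \<open>n\<close> is a record.\<close>
      show "(g, i) \<notin> r" if g: "g \<in> insert (d n) G" and i: "i \<in> I \<union> J" for g i
      proof
        assume gi: "(g, i) \<in> r"
        have "i \<in> J"
        proof (rule ccontr)
          assume "i \<notin> J"
          then have "i \<in> I" using i by simp
          then have "g = d n" using 1(9) g gi by blast
          then show False using gi \<open>i \<in> I\<close> sub(3) antisym by (auto simp: layer_def)
        qed
        then obtain m where "i = d m" "m < n" by (auto simp: J_def split: if_splits)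
        then show False
          using g gi sub(2) assms by (auto simp: layer_def records_def)
      qed
    qed (use 1 in \<open>auto simp: J_def\<close>)
    have "(x, d m) \<notin> r" if "m < n" for m
    proof (cases "L = {}")
      case True
      then show ?thesis using x(4) that by (simp add: J_def)
    next
      case False
      then obtain l where "l \<in> L" by blast
      then show ?thesis using x(2) trans sub(1) that by (fastforce simp: layer_def)
    qed
    then have "x \<in> layer n" using x(3) by (simp add: layer_def)
    with x show ?case by blast
  qed
qed

lemma layer_disjoint: "m \<noteq> n \<Longrightarrow> layer m \<inter> layer n = {}"
  by (auto simp: layer_def) (metis linorder_neqE_nat)

text \<open>If \<open>d\<close> at the least index were below an earlier \<open>d m\<close>, then
  \<open>x\<close> would be too, against minimality. So the points \<open>d n\<close> with
  \<open>n\<close> a record are cofinal.\<close>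

lemma least_record:
  assumes "x \<in> Field r"
  shows "(LEAST n. (x, d n) \<in> r) \<in> records" "(x, d (LEAST n. (x, d n) \<in> r)) \<in> r"
proof -
  have "\<exists>n. (x, d n) \<in> r" using d_surj[OF assms] refl[OF assms] by metis
  then show *: "(x, d (LEAST n. (x, d n) \<in> r)) \<in> r" by (rule LeastI_ex)
  show "(LEAST n. (x, d n) \<in> r) \<in> records"
    unfolding records_def using trans[OF *] not_less_Least by blast
qed

text \<open>Otherwise some point is incomparable to every \<open>d n\<close> with \<open>n\<close> a
  record, although these are cofinal.\<close>

lemma infinite_records: "infinite records"
proof
  assume "finite records"
  then obtain x where x: "x \<in> Field r" "\<And>i. i \<in> d ` records \<Longrightarrow> (x, i) \<notin> r"
    by (rule_tac one_point_extE[OF one_point_ext_Field, of "{}" "{}" "d ` records"])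
      (use d_in_Field in auto)
  then show False using least_record[of x] by blast
qed

text \<open>A layer with two indices would be disjoint from itself, but copies are nonempty.\<close>

lemma inj_layer: "inj_on layer records"
proof (rule inj_onI)
  fix m n assume "m \<in> records" "layer m = layer n"
  then show "m = n"
    using layer_disjoint[of m n] layer_copy[of m] one_point_ext_nonempty[of r "layer m"]
    by (auto simp: copies_iff)
qed

section \<open>The layers form a maximal antichain\<close>

lemma compatible_layer:
  assumes "C \<in> copies r"
  shows "\<exists>n\<in>records. compatible (copies_order r) C (layer n)"
proof -
  have C: "C \<subseteq> Field r" "one_point_ext r C" using assms by (auto simp: copies_iff)
  define h where "h x = (LEAST n. (x, d n) \<in> r)" for x
  obtain c0 where "c0 \<in> C" using one_point_ext_nonempty[OF C(2)] by blast
  then obtain c where c: "c \<in> C" and min: "\<And>x. x \<in> C \<Longrightarrow> h c \<le> h x"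
    using ex_has_least_nat[of "\<lambda>x. x \<in> C" c0 h] by blast
  let ?E = "{x \<in> C. (x, c) \<in> r \<and> x \<noteq> c}"
  have rec: "h c \<in> records" "(c, d (h c)) \<in> r"
    using least_record[of c] c C(1) by (auto simp: h_def)
  have "?E \<subseteq> layer (h c)"
  proof
    fix x assume x: "x \<in> ?E"
    then have "(x, d (h c)) \<in> r" "x \<noteq> d (h c)" using rec(2) trans antisym by blast+
    \<comment> \<open>Here \<open>m < h c <= h x\<close> by the choice of \<open>c\<close>, and
      \<open>h x\<close> is the least index of an enumerated point above \<open>x\<close>.\<close>
    moreover have "(x, d m) \<notin> r" if "m < h c" for m
      using min[of x] x that not_less_Least[of m "\<lambda>n. (x, d n) \<in> r"] by (auto simp: h_def)
    ultimately show "x \<in> layer (h c)" by (simp add: layer_def)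
  qed
  moreover have "?E \<in> copies r"
    using one_point_ext_below[OF C c] C(1) by (auto simp: copies_iff)
  ultimately have "compatible (copies_order r) C (layer (h c))"
    unfolding compatible_copies_iff[OF assms layer_copy[OF rec(1)]] by (intro bexI[of _ ?E]) auto
  with rec(1) show ?thesis by (rule bexI[rotated])
qed

lemma maximal_antichain_layers: "maximal_antichain (copies_order r) (layer ` records)"
  unfolding maximal_antichain_def antichain_def Field_copies_order
proof (intro conjI ballI)
  show "layer ` records \<subseteq> copies r" using layer_copy by blast
  show "pairwise (\<lambda>x y. \<not> compatible (copies_order r) x y) (layer ` records)"
  proof (rule pairwiseI)
    fix A B assume "A \<in> layer ` records" "B \<in> layer ` records" "A \<noteq> B"
    then obtain m n where mn: "m \<in> records" "n \<in> records" "A = layer m" "B = layer n" "m \<noteq> n"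
      by blast
    \<comment> \<open>Disjointness gives incompatibility, since a common lower bound would be an
      empty copy.\<close>
    then have "C = {}" if "C \<subseteq> A" "C \<subseteq> B" for C
      using layer_disjoint[of m n] that by blast
    moreover have "{} \<notin> copies r"
      using one_point_ext_nonempty by (auto simp: copies_iff)
    ultimately show "\<not> compatible (copies_order r) A B"
      using compatible_copies_iff layer_copy mn(1-4) by metis
  qed
  show "\<exists>y\<in>layer ` records. compatible (copies_order r) C y" if "C \<in> copies r" for C
    using compatible_layer[OF that] by blast
qed

end

theorem theorem5p9:
  fixes r :: "'a rel"
  assumes "random_poset r"
  shows "\<exists>S. maximal_antichain (copies_order r) S \<and> countable S \<and> infinite S"
proof -
  interpret random r
    using assms by (simp add: random_poset_def random_def poset_def random_axioms_def)
  have "countable (layer ` records)" by simp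
  moreover have "infinite (layer ` records)"
    using infinite_records inj_layer by (simp add: finite_image_iff)
  ultimately show ?thesis using maximal_antichain_layers by blast
qed

end
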